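(* There exist full proper biharmonic maps from $\mathbb{S}^4$ to $\mathbb{S}^5$ whose components are (restrictions to $\mathbb{S}^4$ of) homogeneous polynomials of degree $2$ on $\mathbb{R}^5$.
   Context: $\mathbb{S}^m$ denotes the unit Euclidean sphere in $\mathbb{R}^{m+1}$ with its round metric. The components of a map $\phi:\mathbb{S}^4\to\mathbb{S}^5$ are its components as a map into $\mathbb{R}^6\supset\mathbb{S}^5$. A map $\phi:\mathbb{S}^m\to\mathbb{S}^n$ is full if its image is not contained in any great sphere of $\mathbb{S}^n$ (intersection of $\mathbb{S}^n$ with a proper linear subspace of $\mathbb{R}^{n+1}$). For a smooth map $\phi:(M,g)\to(N,h)$ between Riemannian manifolds, the tension field is $\tau(\phi)=\operatorname{trace}\nabla d\phi$ and the bitension field is $\tau_2(\phi)=-\Delta\tau(\phi)-\operatorname{trace}R^N(d\phi(\cdot),\tau(\phi))d\phi(\cdot)$, where $\Delta\sigma=-\operatorname{trace}_g\nabla^2\sigma$ is the rough Laplacian on sections of $\phi^{-1}TN$ and $R(X,Y)Z=\nabla_X\nabla_YZ-\nabla_Y\nabla_XZ-\nabla_{[X,Y]}Z$. The map $\phi$ is harmonic if $\tau(\phi)=0$, biharmonic if $\tau_2(\phi)=0$, and proper biharmonic if it is biharmonic and not harmonic. *)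

theory Defs
  imports "HOL-Analysis.Analysis"
begin

text \<open>
  The round unit sphere of a Euclidean space \<open>'a\<close> is \<open>sphere (0::'a) 1\<close>; so the
  four-dimensional sphere is \<open>sphere (0 :: real ^ 5) 1\<close>. Tangent vectors at \<open>p\<close> are identified
  with vectors of the ambient space orthogonal to \<open>p\<close>, the metric being the ambient inner product.
  Maps and vector fields are total functions, but only their values on the sphere matter.
\<close>

definition tangent_space :: "'a::euclidean_space \<Rightarrow> 'a set"
  where "tangent_space p = {v. p \<bullet> v = 0}"

definition tangent_proj :: "'a::euclidean_space \<Rightarrow> 'a \<Rightarrow> 'a"
  where "tangent_proj p v = v - (p \<bullet> v) *\<^sub>R p"

definition orthonormal_basis_of :: "'a::euclidean_space set \<Rightarrow> 'a set \<Rightarrow> bool"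
  where "orthonormal_basis_of W B \<longleftrightarrow>
    B \<subseteq> W \<and> pairwise orthogonal B \<and> (\<forall>e\<in>B. norm e = 1) \<and> span B = W"

text \<open>The choice of the orthonormal basis is immaterial, see \<open>tangent_trace_eq\<close> below.\<close>

definition tangent_trace ::
    "'a::euclidean_space \<Rightarrow> ('a \<Rightarrow> 'a \<Rightarrow> 'b::real_vector) \<Rightarrow> 'b"
  where "tangent_trace p b =
    (\<Sum>e \<in> (SOME B. orthonormal_basis_of (tangent_space p) B). b e e)"

primrec Ck_on :: "nat \<Rightarrow> 'a::euclidean_space set \<Rightarrow> ('a \<Rightarrow> 'b::euclidean_space) \<Rightarrow> bool"
  where
    "Ck_on 0 U f \<longleftrightarrow> continuous_on U f"
  | "Ck_on (Suc k) U f \<longleftrightarrow> (\<forall>x\<in>U. f differentiable (at x)) \<and>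
       (\<forall>v. Ck_on k U (\<lambda>x. frechet_derivative f (at x) v))"

definition smooth_sphere_map :: "('a::euclidean_space \<Rightarrow> 'b::euclidean_space) \<Rightarrow> bool"
  where "smooth_sphere_map \<phi> \<longleftrightarrow> \<phi> ` sphere 0 1 \<subseteq> sphere 0 1 \<and>
    (\<exists>U g. open U \<and> sphere 0 1 \<subseteq> U \<and> (\<forall>k. Ck_on k U g) \<and> (\<forall>x\<in>sphere 0 1. \<phi> x = g x))"

text \<open>
  The differential of a map defined on the sphere. The derivative within the sphere is not unique
  as a linear map on the ambient space, but its values on tangent vectors are; it must only be
  applied to these (see \<open>sphere_deriv_eq\<close> below).
\<close>

definition sphere_deriv ::
    "('a::euclidean_space \<Rightarrow> 'b::euclidean_space) \<Rightarrow> 'a \<Rightarrow> 'a \<Rightarrow> 'b"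
  where "sphere_deriv f p v = frechet_derivative f (at p within sphere 0 1) v"

text \<open>
  The pull-back of the Levi-Civita connection of the sphere in \<open>'b\<close> along \<open>\<phi>\<close>, acting on a section
  \<open>\<sigma>\<close> of the pulled-back tangent bundle, i.e. \<open>\<sigma> p \<in> tangent_space (\<phi> p)\<close>. The Levi-Civita connection
  is the tangential part of the flat connection of the ambient space; the lemmas
  \<open>levi_civita_metric\<close>, \<open>levi_civita_torsion_free\<close> and \<open>pullback_conn_comp\<close> below state its
  characteristic properties.
\<close>

definition pullback_conn ::
    "('a::euclidean_space \<Rightarrow> 'b::euclidean_space) \<Rightarrow> ('a \<Rightarrow> 'b) \<Rightarrow> 'a \<Rightarrow> 'a \<Rightarrow> 'b"
  where "pullback_conn \<phi> \<sigma> p v = tangent_proj (\<phi> p) (sphere_deriv \<sigma> p v)"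

definition levi_civita :: "('a::euclidean_space \<Rightarrow> 'a) \<Rightarrow> ('a \<Rightarrow> 'a) \<Rightarrow> 'a \<Rightarrow> 'a"
  where "levi_civita X Y p = pullback_conn (\<lambda>x. x) Y p (X p)"

definition lie_bracket :: "('a::euclidean_space \<Rightarrow> 'a) \<Rightarrow> ('a \<Rightarrow> 'a) \<Rightarrow> 'a \<Rightarrow> 'a"
  where "lie_bracket X Y p = sphere_deriv Y p (X p) - sphere_deriv X p (Y p)"

definition curvature ::
    "('a::euclidean_space \<Rightarrow> 'a) \<Rightarrow> ('a \<Rightarrow> 'a) \<Rightarrow> ('a \<Rightarrow> 'a) \<Rightarrow> 'a \<Rightarrow> 'a"
  where "curvature X Y Z p =
    levi_civita X (levi_civita Y Z) p - levi_civita Y (levi_civita X Z) p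
      - levi_civita (lie_bracket X Y) Z p"

text \<open>The covariant derivative of the differential: \<open>(\<nabla>d\<phi>)(X, Y)\<close> for tangent vector fields.\<close>

definition nabla_d ::
    "('a::euclidean_space \<Rightarrow> 'b::euclidean_space) \<Rightarrow> ('a \<Rightarrow> 'a) \<Rightarrow> ('a \<Rightarrow> 'a) \<Rightarrow> 'a \<Rightarrow> 'b"
  where "nabla_d \<phi> X Y p =
    pullback_conn \<phi> (\<lambda>q. sphere_deriv \<phi> q (Y q)) p (X p) - sphere_deriv \<phi> p (levi_civita X Y p)"

text \<open>The second covariant derivative of a section: \<open>(\<nabla>\<^sup>2\<sigma>)(X, Y)\<close> for tangent vector fields.\<close>

definition nabla2 ::
    "('a::euclidean_space \<Rightarrow> 'b::euclidean_space) \<Rightarrow> ('a \<Rightarrow> 'b) \<Rightarrow> ('a \<Rightarrow> 'a) \<Rightarrow> ('a \<Rightarrow> 'a) \<Rightarrow> 'a \<Rightarrow> 'b"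
  where "nabla2 \<phi> \<sigma> X Y p =
    pullback_conn \<phi> (\<lambda>q. pullback_conn \<phi> \<sigma> q (Y q)) p (X p)
      - pullback_conn \<phi> \<sigma> p (levi_civita X Y p)"

text \<open>
  \<open>curvature\<close>, \<open>nabla_d\<close> and \<open>nabla2\<close> are tensorial, so they can be evaluated at tangent vectors by
  extending these to arbitrary tangent vector fields; here \<open>v\<close> is extended by projecting it to the
  tangent space at each point.
\<close>

definition extend_field :: "'a::euclidean_space \<Rightarrow> 'a \<Rightarrow> 'a"
  where "extend_field v = (\<lambda>q. tangent_proj q v)"

definition tension :: "('a::euclidean_space \<Rightarrow> 'b::euclidean_space) \<Rightarrow> 'a \<Rightarrow> 'b"
  where "tension \<phi> p =
    tangent_trace p (\<lambda>v w. nabla_d \<phi> (extend_field v) (extend_field w) p)"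

definition rough_laplacian ::
    "('a::euclidean_space \<Rightarrow> 'b::euclidean_space) \<Rightarrow> ('a \<Rightarrow> 'b) \<Rightarrow> 'a \<Rightarrow> 'b"
  where "rough_laplacian \<phi> \<sigma> p =
    - tangent_trace p (\<lambda>v w. nabla2 \<phi> \<sigma> (extend_field v) (extend_field w) p)"

definition bitension :: "('a::euclidean_space \<Rightarrow> 'b::euclidean_space) \<Rightarrow> 'a \<Rightarrow> 'b"
  where "bitension \<phi> p =
    - rough_laplacian \<phi> (tension \<phi>) p
    - tangent_trace p (\<lambda>v w.
        curvature (extend_field (sphere_deriv \<phi> p v)) (extend_field (tension \<phi> p))
          (extend_field (sphere_deriv \<phi> p w)) (\<phi> p))"

definition harmonic :: "('a::euclidean_space \<Rightarrow> 'b::euclidean_space) \<Rightarrow> bool"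
  where "harmonic \<phi> \<longleftrightarrow> smooth_sphere_map \<phi> \<and> (\<forall>p\<in>sphere 0 1. tension \<phi> p = 0)"

definition biharmonic :: "('a::euclidean_space \<Rightarrow> 'b::euclidean_space) \<Rightarrow> bool"
  where "biharmonic \<phi> \<longleftrightarrow> smooth_sphere_map \<phi> \<and> (\<forall>p\<in>sphere 0 1. bitension \<phi> p = 0)"

definition proper_biharmonic :: "('a::euclidean_space \<Rightarrow> 'b::euclidean_space) \<Rightarrow> bool"
  where "proper_biharmonic \<phi> \<longleftrightarrow> biharmonic \<phi> \<and> \<not> harmonic \<phi>"

definition full_sphere_map :: "('a::euclidean_space \<Rightarrow> 'b::euclidean_space) \<Rightarrow> bool"
  where "full_sphere_map \<phi> \<longleftrightarrow>
    \<not> (\<exists>W. subspace W \<and> W \<noteq> UNIV \<and> \<phi> ` sphere 0 1 \<subseteq> sphere 0 1 \<inter> W)"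

definition homogeneous_polynomial :: "nat \<Rightarrow> (real ^ 'n \<Rightarrow> real) \<Rightarrow> bool"
  where "homogeneous_polynomial d P \<longleftrightarrow>
    (\<exists>c :: ('n \<Rightarrow> nat) \<Rightarrow> real. \<forall>x.
       P x = (\<Sum>\<alpha> | (\<Sum>i\<in>UNIV. \<alpha> i) = d. c \<alpha> * (\<Prod>i\<in>UNIV. (x $ i) ^ \<alpha> i)))"


subsection \<open>Well-definedness\<close>

text \<open>The index set in \<open>homogeneous_polynomial\<close> is finite, so the sum is a genuine one.\<close>

lemma finite_multi_indices: "finite {\<alpha> :: 'n::finite \<Rightarrow> nat. (\<Sum>i\<in>UNIV. \<alpha> i) = d}"
proof (rule finite_subset)
  show "{\<alpha> :: 'n \<Rightarrow> nat. (\<Sum>i\<in>UNIV. \<alpha> i) = d} \<subseteq> PiE UNIV (\<lambda>_. {..d})"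
    by (auto simp: PiE_def extensional_def intro: member_le_sum)
  show "finite (PiE (UNIV :: 'n set) (\<lambda>_. {..d}))"
    by (intro finite_PiE) auto
qed

lemma subspace_tangent_space: "subspace (tangent_space p)"
  unfolding tangent_space_def by (rule subspace_hyperplane)

lemma ex_orthonormal_basis_of:
  assumes "subspace W"
  shows "\<exists>B. orthonormal_basis_of W B"
  using orthonormal_basis_subspace[OF assms] unfolding orthonormal_basis_of_def by metis

lemma orthonormal_basis_of_finite:
  assumes "orthonormal_basis_of W B"
  shows "finite B"
  using assms pairwise_orthogonal_imp_finite unfolding orthonormal_basis_of_def by blast

lemma orthonormal_basis_of_inner:
  assumes "orthonormal_basis_of W B" "e \<in> B" "f \<in> B"
  shows "e \<bullet> f = (if e = f then 1 else 0)"
  using assms unfolding orthonormal_basis_of_def pairwise_def orthogonal_def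
  by (auto simp: norm_eq_1)

lemma orthonormal_basis_of_expand:
  assumes B: "orthonormal_basis_of W B" and "x \<in> W"
  shows "(\<Sum>e\<in>B. (x \<bullet> e) *\<^sub>R e) = x"
proof -
  have fin: "finite B" by (rule orthonormal_basis_of_finite[OF B])
  have "x \<in> span B" using assms unfolding orthonormal_basis_of_def by simp
  then obtain u where u: "x = (\<Sum>f\<in>B. u f *\<^sub>R f)"
    using span_finite[OF fin] by auto
  have "x \<bullet> e = u e" if "e \<in> B" for e
  proof -
    have "x \<bullet> e = (\<Sum>f\<in>B. u f * (f \<bullet> e))" by (simp add: u inner_sum_left)
    also have "\<dots> = (\<Sum>f\<in>B. if f = e then u f else 0)"
      by (intro sum.cong) (auto simp: orthonormal_basis_of_inner[OF B _ that])
    also have "\<dots> = u e" using that fin by simp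
    finally show ?thesis .
  qed
  then show ?thesis by (simp add: u)
qed

lemma orthonormal_trace_unique:
  assumes B: "orthonormal_basis_of W B" and C: "orthonormal_basis_of W C" and b: "bilinear b"
  shows "(\<Sum>e\<in>B. b e e) = (\<Sum>f\<in>C. b f f)"
proof -
  have finC: "finite C" by (rule orthonormal_basis_of_finite[OF C])
  have BW: "\<And>e. e \<in> B \<Longrightarrow> e \<in> W" and CW: "\<And>e. e \<in> C \<Longrightarrow> e \<in> W"
    using B C unfolding orthonormal_basis_of_def by auto
  have lin1: "linear (\<lambda>x. b x y)" and lin2: "linear (b y)" for y
    using b unfolding bilinear_def by auto
  have "b e e = (\<Sum>f\<in>C. \<Sum>g\<in>C. ((f \<bullet> e) * (e \<bullet> g)) *\<^sub>R b f g)" if "e \<in> B" for e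
  proof -
    have "b e e = b (\<Sum>f\<in>C. (e \<bullet> f) *\<^sub>R f) (\<Sum>g\<in>C. (e \<bullet> g) *\<^sub>R g)"
      by (simp add: orthonormal_basis_of_expand[OF C BW[OF that]])
    also have "\<dots> = (\<Sum>f\<in>C. (e \<bullet> f) *\<^sub>R b f (\<Sum>g\<in>C. (e \<bullet> g) *\<^sub>R g))"
      by (subst linear_sum[OF lin1]) (simp add: linear_cmul[OF lin1])
    also have "\<dots> = (\<Sum>f\<in>C. \<Sum>g\<in>C. ((f \<bullet> e) * (e \<bullet> g)) *\<^sub>R b f g)"
      by (simp add: linear_sum[OF lin2] linear_cmul[OF lin2] scaleR_sum_right inner_commute)
    finally show ?thesis .
  qed
  then have "(\<Sum>e\<in>B. b e e) = (\<Sum>e\<in>B. \<Sum>f\<in>C. \<Sum>g\<in>C. ((f \<bullet> e) * (e \<bullet> g)) *\<^sub>R b f g)"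
    by simp
  also have "\<dots> = (\<Sum>f\<in>C. \<Sum>g\<in>C. \<Sum>e\<in>B. ((f \<bullet> e) * (e \<bullet> g)) *\<^sub>R b f g)"
    by (subst sum.swap, rule sum.cong[OF refl], rule sum.swap)
  also have "\<dots> = (\<Sum>f\<in>C. \<Sum>g\<in>C. (f \<bullet> g) *\<^sub>R b f g)"
  proof (intro sum.cong refl)
    fix f g assume "f \<in> C" "g \<in> C"
    have "f \<bullet> g = (\<Sum>e\<in>B. (f \<bullet> e) *\<^sub>R e) \<bullet> g"
      by (simp add: orthonormal_basis_of_expand[OF B CW[OF \<open>f \<in> C\<close>]])
    then have "f \<bullet> g = (\<Sum>e\<in>B. (f \<bullet> e) * (e \<bullet> g))"
      by (simp add: inner_sum_left)
    then show "(\<Sum>e\<in>B. ((f \<bullet> e) * (e \<bullet> g)) *\<^sub>R b f g) = (f \<bullet> g) *\<^sub>R b f g"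
      by (simp add: scaleR_sum_left)
  qed
  also have "\<dots> = (\<Sum>f\<in>C. \<Sum>g\<in>C. if g = f then b f g else 0)"
    by (intro sum.cong refl) (auto simp: orthonormal_basis_of_inner[OF C])
  also have "\<dots> = (\<Sum>f\<in>C. b f f)"
    using finC by (intro sum.cong refl) simp
  finally show ?thesis .
qed

lemma tangent_trace_eq:
  assumes "orthonormal_basis_of (tangent_space p) B" "bilinear b"
  shows "tangent_trace p b = (\<Sum>e\<in>B. b e e)"
  unfolding tangent_trace_def
  using assms orthonormal_trace_unique
    someI_ex[OF ex_orthonormal_basis_of[OF subspace_tangent_space[of p]]]
  by blast

lemma sphere_curve:
  fixes p v :: "'a::euclidean_space"
  assumes p: "p \<in> sphere 0 1" and v: "v \<in> tangent_space p"
  obtains c :: "real \<Rightarrow> 'a"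
  where "c 0 = p" "\<And>t. c t \<in> sphere 0 1" "(c has_vector_derivative v) (at 0)"
proof (cases "v = 0")
  case True
  show ?thesis by (rule that[of "\<lambda>_. p"]) (use p True in auto)
next
  case False
  define n where "n = norm v"
  have n: "n \<noteq> 0" using False by (simp add: n_def)
  define c where "c = (\<lambda>t. cos (n * t) *\<^sub>R p + (sin (n * t) / n) *\<^sub>R v)"
  have pp: "p \<bullet> p = 1" using p by (simp add: norm_eq_1)
  have pv: "p \<bullet> v = 0" "v \<bullet> p = 0"
    using v by (simp_all add: tangent_space_def inner_commute)
  have vv: "v \<bullet> v = n\<^sup>2" by (simp add: n_def power2_norm_eq_inner)
  show ?thesis
  proof (rule that[of c])
    show "c 0 = p" by (simp add: c_def)
    show "c t \<in> sphere 0 1" for t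
    proof -
      have "c t \<bullet> c t = (cos (n * t))\<^sup>2 + (sin (n * t))\<^sup>2"
        using n by (simp add: c_def inner_add_left inner_add_right pp pv vv power2_eq_square)
      then show ?thesis by (simp add: norm_eq_1)
    qed
    show "(c has_vector_derivative v) (at 0)"
      unfolding c_def using n
      by (auto intro!: derivative_eq_intros)
  qed
qed

lemma sphere_has_derivative_unique:
  assumes p: "p \<in> sphere 0 1" and v: "v \<in> tangent_space p"
    and D: "(f has_derivative D) (at p within sphere 0 1)"
    and E: "(f has_derivative E) (at p within sphere 0 1)"
  shows "D v = E v"
proof -
  obtain c where c: "c 0 = p" "\<And>t. c t \<in> sphere 0 1" "(c has_vector_derivative v) (at 0)"
    using sphere_curve[OF p v] by blast
  have *: "((f \<circ> c) has_vector_derivative L v) (at 0)"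
    if L: "(f has_derivative L) (at p within sphere 0 1)" for L
  proof -
    have "(f has_derivative L) (at (c 0) within range c)"
      unfolding c(1) by (rule has_derivative_subset[OF L]) (use c(2) in blast)
    then have "((f \<circ> c) has_derivative (L \<circ> (\<lambda>t. t *\<^sub>R v))) (at 0)"
      using c(3) diff_chain_within[of c "\<lambda>t. t *\<^sub>R v" 0 UNIV f L]
      by (simp add: has_vector_derivative_def)
    then show ?thesis
      using has_derivative_bounded_linear[OF L]
      by (simp add: has_vector_derivative_def o_def linear_simps)
  qed
  show ?thesis
    by (rule vector_derivative_unique_at[OF *[OF D] *[OF E]])
qed

lemma sphere_deriv_eq:
  assumes "p \<in> sphere 0 1" "v \<in> tangent_space p" "(f has_derivative D) (at p within sphere 0 1)"
  shows "sphere_deriv f p v = D v"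
  unfolding sphere_deriv_def
  by (rule sphere_has_derivative_unique[OF assms(1,2) _ assms(3)])
     (use assms(3) frechet_derivative_works differentiableI in blast)

lemma sphere_deriv_works:
  assumes "f differentiable (at p within sphere 0 1)"
  shows "(f has_derivative sphere_deriv f p) (at p within sphere 0 1)"
  using assms unfolding sphere_deriv_def [abs_def] frechet_derivative_works by simp

lemma inner_tangent_proj:
  assumes "w \<in> tangent_space p"
  shows "tangent_proj p u \<bullet> w = u \<bullet> w"
  using assms by (simp add: tangent_proj_def tangent_space_def inner_diff_left)

lemma tangent_proj_in:
  assumes "p \<in> sphere 0 1"
  shows "tangent_proj p u \<in> tangent_space p"
  using assms by (simp add: tangent_proj_def tangent_space_def inner_diff_right norm_eq_1)

lemma tangent_proj_id: "w \<in> tangent_space p \<Longrightarrow> tangent_proj p w = w"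
  by (simp add: tangent_proj_def tangent_space_def)

lemma tangent_proj_diff: "tangent_proj p (u - w) = tangent_proj p u - tangent_proj p w"
  by (simp add: tangent_proj_def algebra_simps)

lemma levi_civita_metric:
  assumes p: "p \<in> sphere 0 1" and X: "X p \<in> tangent_space p"
    and Y: "Y p \<in> tangent_space p" "Y differentiable (at p within sphere 0 1)"
    and Z: "Z p \<in> tangent_space p" "Z differentiable (at p within sphere 0 1)"
  shows "sphere_deriv (\<lambda>q. Y q \<bullet> Z q) p (X p) =
    levi_civita X Y p \<bullet> Z p + Y p \<bullet> levi_civita X Z p"
proof -
  have "((\<lambda>q. Y q \<bullet> Z q) has_derivative (\<lambda>v. Y p \<bullet> sphere_deriv Z p v + sphere_deriv Y p v \<bullet> Z p))
          (at p within sphere 0 1)"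
    by (rule has_derivative_inner[OF sphere_deriv_works[OF Y(2)] sphere_deriv_works[OF Z(2)]])
  from sphere_deriv_eq[OF p X this] show ?thesis
    by (simp add: levi_civita_def pullback_conn_def inner_tangent_proj[OF Z(1)]
        inner_commute[of "Y p"] inner_tangent_proj[OF Y(1)])
qed

lemma lie_bracket_tangent:
  assumes p: "p \<in> sphere 0 1"
    and X: "\<And>q. q \<in> sphere 0 1 \<Longrightarrow> X q \<in> tangent_space q" "X differentiable (at p within sphere 0 1)"
    and Y: "\<And>q. q \<in> sphere 0 1 \<Longrightarrow> Y q \<in> tangent_space q" "Y differentiable (at p within sphere 0 1)"
  shows "lie_bracket X Y p \<in> tangent_space p"
proof -
  have *: "p \<bullet> sphere_deriv Z p v = - (v \<bullet> Z p)"
    if Z: "\<And>q. q \<in> sphere 0 1 \<Longrightarrow> Z q \<in> tangent_space q" "Z differentiable (at p within sphere 0 1)"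
      and v: "v \<in> tangent_space p" for Z v
  proof -
    have "((\<lambda>q. q \<bullet> Z q) has_derivative (\<lambda>v. p \<bullet> sphere_deriv Z p v + v \<bullet> Z p))
            (at p within sphere 0 1)"
      by (rule has_derivative_inner[OF has_derivative_ident sphere_deriv_works[OF Z(2)]])
    moreover have "((\<lambda>q. q \<bullet> Z q) has_derivative (\<lambda>v. 0)) (at p within sphere 0 1)"
      by (rule has_derivative_transform[OF p _ has_derivative_const[of 0]])
         (use Z(1) in \<open>simp add: tangent_space_def\<close>)
    ultimately have "p \<bullet> sphere_deriv Z p v + v \<bullet> Z p = 0"
      using sphere_has_derivative_unique[OF p v] by blast
    then show ?thesis by simp
  qed
  show ?thesis
    using *[OF X Y(1)[OF p]] *[OF Y X(1)[OF p]]
    by (simp add: lie_bracket_def tangent_space_def inner_diff_right inner_commute)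
qed

lemma levi_civita_torsion_free:
  assumes p: "p \<in> sphere 0 1"
    and X: "\<And>q. q \<in> sphere 0 1 \<Longrightarrow> X q \<in> tangent_space q" "X differentiable (at p within sphere 0 1)"
    and Y: "\<And>q. q \<in> sphere 0 1 \<Longrightarrow> Y q \<in> tangent_space q" "Y differentiable (at p within sphere 0 1)"
  shows "levi_civita X Y p - levi_civita Y X p = lie_bracket X Y p"
  using tangent_proj_id[OF lie_bracket_tangent[OF assms]]
  by (simp add: levi_civita_def pullback_conn_def lie_bracket_def tangent_proj_diff)

lemma pullback_conn_comp:
  assumes p: "p \<in> sphere 0 1" and v: "v \<in> tangent_space p"
    and \<phi>: "\<phi> ` sphere 0 1 \<subseteq> sphere 0 1" "\<phi> differentiable (at p within sphere 0 1)"
    and W: "W differentiable (at (\<phi> p) within sphere 0 1)"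
  shows "pullback_conn \<phi> (W \<circ> \<phi>) p v = pullback_conn (\<lambda>x. x) W (\<phi> p) (sphere_deriv \<phi> p v)"
proof -
  have "(W has_derivative sphere_deriv W (\<phi> p)) (at (\<phi> p) within \<phi> ` sphere 0 1)"
    by (rule has_derivative_subset[OF sphere_deriv_works[OF W] \<phi>(1)])
  from diff_chain_within[OF sphere_deriv_works[OF \<phi>(2)] this]
  have "((W \<circ> \<phi>) has_derivative (sphere_deriv W (\<phi> p) \<circ> sphere_deriv \<phi> p)) (at p within sphere 0 1)" .
  from sphere_deriv_eq[OF p v this] show ?thesis
    by (simp add: pullback_conn_def)
qed

end

theory Submission
  imports Defs
begin

text \<open>
  The map is a harmonic map of spheres followed by the inclusion of a small sphere. Let
  \<open>f\<close> be Cartan's isoparametric cubic on \<open>\<real>\<^sup>5\<close>, the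
  determinant on traceless symmetric \<open>3 \<times> 3\<close> matrices up to a factor. It is
  harmonic and satisfies \<open>\<bar>\<nabla>f\<bar>\<^sup>2 = 9 \<bar>x\<bar>\<^sup>4\<close>, so
  \<open>\<nabla>f / 3\<close> maps the unit sphere of \<open>\<real>\<^sup>5\<close> to itself, by
  five harmonic quadratic forms. Placing its image at the latitude \<open>1 / sqrt 2\<close> of
  \<open>\<real>\<^sup>6\<close> gives \<open>(\<nabla>f / 3, \<bar>x\<bar>\<^sup>2) / sqrt
  2\<close>, whose components are again quadratic forms, linearly independent on the sphere. That
  the result is proper biharmonic is an instance of a fact on quadratic maps of spheres.

  Let \<open>F x = B x x\<close> with \<open>B\<close> symmetric bilinear on a space of dimension
  \<open>N\<close> and \<open>\<bar>F x\<bar> = \<bar>x\<bar>\<^sup>2\<close>. The Euclidean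
  Laplacian of \<open>F\<close> is a constant vector \<open>c\<close>, and the tension field on the
  sphere is the projection \<open>\<tau> = c - (c \<bullet> F) F\<close>
  (\<open>tension_quad\<close>). Polarizing \<open>\<bar>F x\<bar>\<^sup>2 =
  \<bar>x\<bar>\<^sup>4\<close> gives the energy density \<open>\<bar>dF\<bar>\<^sup>2 = 2 N - c
  \<bullet> F\<close> (\<open>tangent_trace_energy\<close>). Suppose now that \<open>c \<bullet>
  F\<close> is a constant \<open>h\<close> on the sphere, so that the image lies on a small sphere
  orthogonal to \<open>c\<close>. Then \<open>\<tau> = c - h F\<close> is orthogonal to the image of
  \<open>dF\<close> and its covariant derivative is \<open>- h dF\<close>, whence the trace of
  \<open>\<nabla>\<^sup>2\<tau>\<close> is \<open>- h \<tau>\<close>. As the target has curvature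
  \<open>R(X,Y)Z = (Y \<bullet> Z) X - (X \<bullet> Z) Y\<close>, the curvature term of the
  bitension field contributes \<open>\<bar>dF\<bar>\<^sup>2 \<tau>\<close>. Altogether
  \<open>\<tau>\<^sub>2 = (2 N - 2 h) \<tau>\<close>, which vanishes for \<open>h = N\<close>. In
  that case \<open>\<bar>c\<bar>\<^sup>2 = 2 N\<^sup>2\<close>, because \<open>c\<close> is twice
  the sum of the values of \<open>F\<close> on an orthonormal basis; hence
  \<open>\<bar>\<tau>\<bar>\<^sup>2 = N\<^sup>2\<close> and \<open>F\<close> is not harmonic.

  For the map above \<open>c = (0, 10) / sqrt 2\<close>, and \<open>c \<bullet> F = 5
  \<bar>x\<bar>\<^sup>2\<close> as required.
\<close>

section \<open>Traces over tangent spaces\<close>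

lemma tangent_trace_cong:
  assumes "\<And>v. v \<in> tangent_space p \<Longrightarrow> b v v = b' v v"
  shows "tangent_trace p b = tangent_trace p b'"
proof -
  define E where "E = (SOME E. orthonormal_basis_of (tangent_space p) E)"
  have "orthonormal_basis_of (tangent_space p) E"
    unfolding E_def by (rule someI_ex[OF ex_orthonormal_basis_of[OF subspace_tangent_space]])
  then have "E \<subseteq> tangent_space p" by (simp add: orthonormal_basis_of_def)
  then have "(\<Sum>e\<in>E. b e e) = (\<Sum>e\<in>E. b' e e)"
    by (intro sum.cong refl assms) blast
  then show ?thesis by (simp add: tangent_trace_def E_def)
qed

text \<open>
  Adjoining the normal vector \<open>p\<close> to an orthonormal basis of the tangent space gives
  one of the whole space, over which the trace can be taken in the standard basis.
\<close>

lemma tangent_trace_bilinear: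
  fixes p :: "'a::euclidean_space"
  assumes p: "p \<in> sphere 0 1" and b: "bilinear b"
  shows "tangent_trace p b = (\<Sum>e\<in>Basis. b e e) - b p p"
proof -
  obtain E where E: "orthonormal_basis_of (tangent_space p) E"
    using ex_orthonormal_basis_of[OF subspace_tangent_space] by blast
  have pp: "p \<bullet> p = 1" using p by (simp add: norm_eq_1)
  have ET: "p \<bullet> e = 0" if "e \<in> E" for e
    using E that by (auto simp: orthonormal_basis_of_def tangent_space_def)
  have pE: "p \<notin> E" using ET[of p] pp by auto
  have "orthonormal_basis_of UNIV (insert p E)"
    unfolding orthonormal_basis_of_def
  proof (intro conjI)
    show "pairwise orthogonal (insert p E)"
      using E ET unfolding orthonormal_basis_of_def pairwise_insert
      by (auto simp: orthogonal_def inner_commute)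
    show "\<forall>e\<in>insert p E. norm e = 1"
      using E p by (auto simp: orthonormal_basis_of_def)
    have "x \<in> span (insert p E)" for x
    proof -
      have "tangent_proj p x \<in> span E"
        using tangent_proj_in[OF p] E by (simp add: orthonormal_basis_of_def)
      then show ?thesis
        unfolding span_insert tangent_proj_def by blast
    qed
    then show "span (insert p E) = UNIV" by blast
  qed simp
  moreover have "orthonormal_basis_of UNIV (Basis :: 'a set)"
    by (auto simp: orthonormal_basis_of_def pairwise_def orthogonal_def inner_not_same_Basis)
  ultimately have "(\<Sum>e\<in>Basis. b e e) = (\<Sum>e\<in>insert p E. b e e)"
    by (rule orthonormal_trace_unique[OF _ _ b, rotated])
  also have "\<dots> = b p p + (\<Sum>e\<in>E. b e e)"
    using pE orthonormal_basis_of_finite[OF E] by simp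
  finally show ?thesis
    by (simp add: tangent_trace_eq[OF E b])
qed

section \<open>Projected fields and the curvature of the sphere\<close>

text \<open>
  Tension fields and covariant derivatives have closed formulas only on the sphere; this suffices to
  differentiate them.
\<close>

lemma sphere_deriv_transform:
  assumes p: "p \<in> sphere 0 1" and v: "v \<in> tangent_space p"
    and eq: "\<And>q. q \<in> sphere 0 1 \<Longrightarrow> f q = g q"
    and g: "(g has_derivative D) (at p within sphere 0 1)"
  shows "sphere_deriv f p v = D v"
  by (rule sphere_deriv_eq[OF p v has_derivative_transform[OF p eq g]])

lemma extend_field_at: "v \<in> tangent_space p \<Longrightarrow> extend_field v p = v"
  by (simp add: extend_field_def tangent_proj_id)

lemma extend_field_tangent: "p \<in> sphere 0 1 \<Longrightarrow> extend_field v p \<in> tangent_space p"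
  by (simp add: extend_field_def tangent_proj_in)

lemma extend_field_has_derivative:
  "(extend_field w has_derivative (\<lambda>v. - ((v \<bullet> w) *\<^sub>R p + (p \<bullet> w) *\<^sub>R v))) (at p within S)"
  unfolding extend_field_def tangent_proj_def
  by (auto intro!: derivative_eq_intros simp: algebra_simps)

lemma sphere_deriv_extend_field:
  assumes "p \<in> sphere 0 1" "v \<in> tangent_space p"
  shows "sphere_deriv (extend_field w) p v = - ((v \<bullet> w) *\<^sub>R p + (p \<bullet> w) *\<^sub>R v)"
  by (rule sphere_deriv_eq[OF assms extend_field_has_derivative])

lemma linear_tangent_proj: "linear (tangent_proj p)"
  unfolding tangent_proj_def by (auto intro!: linearI simp: algebra_simps)

lemma tangent_proj_self: "p \<in> sphere 0 1 \<Longrightarrow> tangent_proj p p = 0"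
  by (simp add: tangent_proj_def norm_eq_1)

text \<open>
  The field \<open>extend_field w\<close> is the gradient on the sphere of the height function
  \<open>q \<mapsto> q \<bullet> w\<close>, whose Hessian is minus that function times the metric.
  In particular the field is parallel at the points orthogonal to \<open>w\<close>, which is why the
  correction terms in \<open>nabla_d\<close> and \<open>nabla2\<close> vanish below.
\<close>

lemma levi_civita_extend_field:
  assumes p: "p \<in> sphere 0 1"
  shows "levi_civita (extend_field v) (extend_field w) p = - (p \<bullet> w) *\<^sub>R extend_field v p"
proof -
  have T: "extend_field v p \<in> tangent_space p"
    by (rule extend_field_tangent[OF p])
  have "tangent_proj p (- ((extend_field v p \<bullet> w) *\<^sub>R p + (p \<bullet> w) *\<^sub>R extend_field v p))
    = - (p \<bullet> w) *\<^sub>R extend_field v p"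
    by (simp only: linear_neg[OF linear_tangent_proj] linear_add[OF linear_tangent_proj]
        linear_cmul[OF linear_tangent_proj] tangent_proj_self[OF p] tangent_proj_id[OF T]) simp
  then show ?thesis
    by (simp add: levi_civita_def pullback_conn_def sphere_deriv_extend_field[OF p T])
qed

lemma levi_civita_extend_field_twice:
  assumes y: "y \<in> sphere 0 1"
    and T: "a \<in> tangent_space y" "b \<in> tangent_space y" "d \<in> tangent_space y"
  shows "levi_civita (extend_field a) (levi_civita (extend_field b) (extend_field d)) y
    = - (a \<bullet> d) *\<^sub>R b"
proof -
  have "((\<lambda>q. - (q \<bullet> d) *\<^sub>R extend_field b q) has_derivative
      (\<lambda>v. - (y \<bullet> d) *\<^sub>R (- ((v \<bullet> b) *\<^sub>R y + (y \<bullet> b) *\<^sub>R v)) + (- (v \<bullet> d)) *\<^sub>R extend_field b y))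
      (at y within sphere 0 1)"
    by (rule has_derivative_scaleR[OF _ extend_field_has_derivative])
       (auto intro!: derivative_eq_intros)
  from sphere_deriv_transform[OF y T(1) levi_civita_extend_field this]
  have "sphere_deriv (levi_civita (extend_field b) (extend_field d)) y a = - (a \<bullet> d) *\<^sub>R b"
    using T by (simp add: extend_field_at tangent_space_def)
  then show ?thesis
    using T by (simp add: levi_civita_def pullback_conn_def extend_field_at
        linear_neg[OF linear_tangent_proj] linear_cmul[OF linear_tangent_proj] tangent_proj_id)
qed

lemma curvature_sphere:
  assumes y: "y \<in> sphere 0 1"
    and T: "a \<in> tangent_space y" "b \<in> tangent_space y" "d \<in> tangent_space y"
  shows "curvature (extend_field a) (extend_field b) (extend_field d) y
    = (b \<bullet> d) *\<^sub>R a - (a \<bullet> d) *\<^sub>R b"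
proof -
  have "lie_bracket (extend_field a) (extend_field b) y = 0"
    using T by (simp add: lie_bracket_def extend_field_at sphere_deriv_extend_field[OF y]
        tangent_space_def inner_commute)
  then have "levi_civita (lie_bracket (extend_field a) (extend_field b)) (extend_field d) y = 0"
    by (simp add: levi_civita_def pullback_conn_def sphere_deriv_extend_field[OF y]
        tangent_space_def tangent_proj_def)
  then show ?thesis
    by (simp add: curvature_def levi_civita_extend_field_twice[OF y] T)
qed

section \<open>Smoothness of linear maps\<close>

lemma Ck_on_const: "Ck_on k UNIV (\<lambda>x. c)"
  by (induction k arbitrary: c) auto

lemma Ck_on_bounded_linear:
  assumes "bounded_linear f"
  shows "Ck_on k UNIV f"
proof (cases k)
  case 0
  then show ?thesis by (simp add: linear_continuous_on assms)
next
  case (Suc j)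
  have "frechet_derivative f (at x) = f" for x
    using frechet_derivative_at[OF bounded_linear_imp_has_derivative[OF assms]] by simp
  then show ?thesis
    using Suc assms by (auto simp: Ck_on_const intro: bounded_linear_imp_differentiable)
qed

section \<open>Quadratic maps between spheres\<close>

lemma inner_self_trinomial:
  fixes x y z :: "'a::real_inner"
  shows "(x + a *\<^sub>R y + b *\<^sub>R z) \<bullet> (x + a *\<^sub>R y + b *\<^sub>R z)
    = x \<bullet> x + 2 * a * (x \<bullet> y) + 2 * b * (x \<bullet> z) + a\<^sup>2 * (y \<bullet> y) + 2 * a * b * (y \<bullet> z) + b\<^sup>2 * (z \<bullet> z)"
  by (simp add: inner_add_left inner_add_right inner_commute[of y x] inner_commute[of z x]
      inner_commute[of z y] algebra_simps power2_eq_square)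

locale spherical_quadratic =
  fixes B :: "'a::euclidean_space \<Rightarrow> 'a \<Rightarrow> 'b::euclidean_space"
  assumes bilin: "bounded_bilinear B"
    and sym: "B x y = B y x"
    and norm_diag: "norm (B x x) = (norm x)\<^sup>2"
begin

definition quad :: "'a \<Rightarrow> 'b"
  where "quad x = B x x"

text \<open>
  The Euclidean Laplacian of \<open>quad\<close>, which is constant.
\<close>

definition laplace :: 'b
  where "laplace = 2 *\<^sub>R (\<Sum>b\<in>Basis. B b b)"

lemmas B_add_left = bounded_bilinear.add_left[OF bilin]
lemmas B_add_right = bounded_bilinear.add_right[OF bilin]
lemmas B_scaleR_left = bounded_bilinear.scaleR_left[OF bilin]
lemmas B_scaleR_right = bounded_bilinear.scaleR_right[OF bilin]

lemma quad_scaleR: "quad (k *\<^sub>R x) = k\<^sup>2 *\<^sub>R quad x"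
  by (simp add: quad_def B_scaleR_left B_scaleR_right power2_eq_square)

lemma quad_has_derivative: "(quad has_derivative (\<lambda>v. 2 *\<^sub>R B x v)) (at x within S)"
proof -
  have "((\<lambda>x. B x x) has_derivative (\<lambda>v. B x v + B v x)) (at x within S)"
    by (rule bounded_bilinear.FDERIV[OF bilin has_derivative_ident has_derivative_ident])
  moreover have "(\<lambda>v. B x v + B v x) = (\<lambda>v. 2 *\<^sub>R B x v)"
    by (simp add: sym[of _ x] scaleR_2)
  ultimately show ?thesis by (simp add: quad_def[abs_def])
qed

lemma sphere_deriv_quad:
  "p \<in> sphere 0 1 \<Longrightarrow> v \<in> tangent_space p \<Longrightarrow> sphere_deriv quad p v = 2 *\<^sub>R B p v"
  by (rule sphere_deriv_eq[OF _ _ quad_has_derivative])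

lemma quad_sphere: "p \<in> sphere 0 1 \<Longrightarrow> quad p \<in> sphere 0 1"
  by (simp add: quad_def norm_diag)

lemma smooth_quad: "smooth_sphere_map quad"
proof -
  have der: "frechet_derivative quad (at x) v = 2 *\<^sub>R B x v" for x v
    using frechet_derivative_at[OF quad_has_derivative, of x] by metis
  have "Ck_on k UNIV quad" for k
  proof (cases k)
    case 0
    then show ?thesis
      by (auto simp: continuous_on_eq_continuous_within
          intro: has_derivative_continuous[OF quad_has_derivative])
  next
    case (Suc j)
    have "bounded_linear (\<lambda>x. 2 *\<^sub>R B x v)" for v
      by (rule bounded_linear_const_scaleR[OF bounded_bilinear.bounded_linear_left[OF bilin]])
    then show ?thesis
      using Suc quad_has_derivative
      by (auto simp: der differentiable_def intro: Ck_on_bounded_linear)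
  qed
  then show ?thesis
    unfolding smooth_sphere_map_def using quad_sphere by blast
qed

text \<open>
  The two identities are the coefficients of \<open>t\<close> and \<open>t\<^sup>2\<close> in
  \<open>\<bar>quad (p + t v)\<bar>\<^sup>2 = (1 + t\<^sup>2 \<bar>v\<bar>\<^sup>2)\<^sup>2\<close>.
  The first says that \<open>quad\<close> maps the sphere to the sphere; the second, summed over a
  basis, computes the energy density.
\<close>

lemma norm_diag_polarized:
  assumes p: "p \<in> sphere 0 1" and v: "v \<in> tangent_space p"
  shows "quad p \<bullet> B p v = 0"
    and "4 * (B p v \<bullet> B p v) = 2 * (v \<bullet> v) - 2 * (quad p \<bullet> B v v)"
proof -
  have pv: "p \<bullet> v = 0" "p \<bullet> p = 1"
    using assms by (simp_all add: tangent_space_def norm_eq_1)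
  have n: "B x x \<bullet> B x x = (x \<bullet> x)\<^sup>2" for x
    using norm_diag[of x] by (metis power2_norm_eq_inner)
  define a b d r where "a = quad p \<bullet> B p v" and "b = B p v \<bullet> B v v"
    and "d = 4 * (B p v \<bullet> B p v) + 2 * (quad p \<bullet> B v v)" and "r = v \<bullet> v"
  have exp: "1 + 4 * t * a + t\<^sup>2 * d + 4 * t^3 * b + t^4 * r\<^sup>2 = 1 + 2 * t\<^sup>2 * r + t^4 * r\<^sup>2" for t :: real
  proof -
    have "B (p + t *\<^sub>R v) (p + t *\<^sub>R v) = B p p + (2 * t) *\<^sub>R B p v + t\<^sup>2 *\<^sub>R B v v"
      by (simp add: B_add_left B_add_right B_scaleR_left B_scaleR_right sym[of v p]
          algebra_simps power2_eq_square scaleR_2 flip: scaleR_scaleR)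
    moreover have "(p + t *\<^sub>R v) \<bullet> (p + t *\<^sub>R v) = 1 + t\<^sup>2 * r"
      by (simp add: inner_add_left inner_add_right pv inner_commute[of v p] r_def power2_eq_square)
    ultimately have "(B p p + (2 * t) *\<^sub>R B p v + t\<^sup>2 *\<^sub>R B v v)
      \<bullet> (B p p + (2 * t) *\<^sub>R B p v + t\<^sup>2 *\<^sub>R B v v) = (1 + t\<^sup>2 * r)\<^sup>2"
      using n[of "p + t *\<^sub>R v"] by simp
    moreover have "(B p p + (2 * t) *\<^sub>R B p v + t\<^sup>2 *\<^sub>R B v v)
      \<bullet> (B p p + (2 * t) *\<^sub>R B p v + t\<^sup>2 *\<^sub>R B v v) =
      B p p \<bullet> B p p + 4 * t * a + t\<^sup>2 * d + 4 * t^3 * b + t^4 * (B v v \<bullet> B v v)"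
      unfolding inner_self_trinomial a_def b_def d_def quad_def by algebra
    moreover have "(1 + t\<^sup>2 * r)\<^sup>2 = 1 + 2 * t\<^sup>2 * r + t^4 * r\<^sup>2"
      by (simp add: power2_eq_square power4_eq_xxxx algebra_simps)
    ultimately show ?thesis
      using n[of v] n[of p] pv by (simp add: r_def)
  qed
  \<comment> \<open>The odd unknowns \<open>a\<close>, \<open>b\<close> and the even unknown \<open>d\<close> are separated by evaluating at
    \<open>t = 1\<close>, \<open>-1\<close> and \<open>2\<close>.\<close>
  have "a = 0 \<and> d = 2 * r"
    using exp[of 1] exp[of "-1"] exp[of 2] by auto
  then show "quad p \<bullet> B p v = 0"
    and "4 * (B p v \<bullet> B p v) = 2 * (v \<bullet> v) - 2 * (quad p \<bullet> B v v)"
    by (simp_all add: a_def d_def r_def)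
qed

lemma quad_tangent:
  assumes "p \<in> sphere 0 1" "v \<in> tangent_space p"
  shows "B p v \<in> tangent_space (quad p)"
  using norm_diag_polarized(1)[OF assms] by (simp add: tangent_space_def)

text \<open>
  Up to the factor \<open>k\<close>, both the differential of \<open>quad\<close> and, at constant
  height, the covariant derivative of its tension field have the form of \<open>f\<close>, so this
  is the derivative needed for \<open>nabla_d\<close> as well as \<open>nabla2\<close>.
\<close>

lemma sphere_deriv_quad_field:
  assumes p: "p \<in> sphere 0 1" and v: "v \<in> tangent_space p" and w: "w \<in> tangent_space p"
    and f: "\<And>q. q \<in> sphere 0 1 \<Longrightarrow> f q = k *\<^sub>R B q (extend_field w q)"
  shows "sphere_deriv f p v = k *\<^sub>R (B v w - (v \<bullet> w) *\<^sub>R quad p)"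
proof -
  have "((\<lambda>q. k *\<^sub>R B q (extend_field w q)) has_derivative
      (\<lambda>u. k *\<^sub>R (B p (- ((u \<bullet> w) *\<^sub>R p + (p \<bullet> w) *\<^sub>R u)) + B u (extend_field w p))))
      (at p within sphere 0 1)"
    by (intro has_derivative_scaleR_right
        bounded_bilinear.FDERIV[OF bilin has_derivative_ident extend_field_has_derivative])
  from sphere_deriv_transform[OF p v f this] show ?thesis
    using w by (simp add: extend_field_at tangent_space_def quad_def B_scaleR_right
        bounded_bilinear.minus_right[OF bilin])
qed

lemma nabla_d_quad:
  assumes p: "p \<in> sphere 0 1" and v: "v \<in> tangent_space p" and w: "w \<in> tangent_space p"
  shows "nabla_d quad (extend_field v) (extend_field w) p = tangent_proj (quad p) (2 *\<^sub>R B v w)"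
proof -
  have "sphere_deriv (\<lambda>q. sphere_deriv quad q (extend_field w q)) p v
      = 2 *\<^sub>R (B v w - (v \<bullet> w) *\<^sub>R quad p)"
    by (rule sphere_deriv_quad_field[OF p v w]) (simp add: sphere_deriv_quad extend_field_tangent)
  moreover have "levi_civita (extend_field v) (extend_field w) p = 0"
    using w by (simp add: levi_civita_extend_field[OF p] tangent_space_def)
  moreover have "sphere_deriv quad p 0 = 0"
    by (simp add: sphere_deriv_quad[OF p] tangent_space_def bounded_bilinear.zero_right[OF bilin])
  ultimately show ?thesis
    by (simp add: nabla_d_def pullback_conn_def extend_field_at[OF v] tangent_proj_diff
        linear_cmul[OF linear_tangent_proj] tangent_proj_self[OF quad_sphere[OF p]])
qed

text \<open>
  The trace of \<open>2 B\<close> over the whole space is \<open>laplace\<close>; the normal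
  direction \<open>p\<close> accounts for the other term.
\<close>

lemma tangent_trace_B:
  assumes p: "p \<in> sphere 0 1" and L: "linear L"
  shows "tangent_trace p (\<lambda>v w. L (2 *\<^sub>R B v w)) = L (laplace - 2 *\<^sub>R quad p)"
proof -
  have "bilinear (\<lambda>v w. L (2 *\<^sub>R B v w))"
    unfolding bilinear_def
    by (auto intro!: linearI simp: B_add_left B_add_right B_scaleR_left B_scaleR_right
        scaleR_add_right linear_add[OF L] linear_cmul[OF L] scaleR_left_commute)
  from tangent_trace_bilinear[OF p this] show ?thesis
    by (simp add: laplace_def quad_def linear_diff[OF L] scaleR_sum_right linear_sum[OF L])
qed

text \<open>
  The normal contribution to the trace is a multiple of \<open>quad p\<close>, so the projection
  removes it.
\<close>

lemma tension_quad:
  assumes p: "p \<in> sphere 0 1"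
  shows "tension quad p = tangent_proj (quad p) laplace"
proof -
  have "tension quad p = tangent_trace p (\<lambda>v w. tangent_proj (quad p) (2 *\<^sub>R B v w))"
    unfolding tension_def by (intro tangent_trace_cong nabla_d_quad p)
  also have "\<dots> = tangent_proj (quad p) laplace"
    unfolding tangent_trace_B[OF p linear_tangent_proj]
    by (simp add: tangent_proj_diff
        linear_cmul[OF linear_tangent_proj] tangent_proj_self[OF quad_sphere[OF p]])
  finally show ?thesis .
qed

text \<open>
  Since \<open>2 B p\<close> is the differential of \<open>quad\<close>, the scalar factor on the
  right is the energy density. It arises in the curvature term of the bitension field, multiplied by
  a vector \<open>s\<close>.
\<close>

lemma tangent_trace_energy:
  assumes p: "p \<in> sphere 0 1"
  shows "tangent_trace p (\<lambda>v w. (4 * (B p v \<bullet> B p w)) *\<^sub>R s)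
    = (2 * DIM('a) - laplace \<bullet> quad p) *\<^sub>R s"
proof -
  let ?b = "\<lambda>v w. (2 * (v \<bullet> w) - quad p \<bullet> (2 *\<^sub>R B v w)) *\<^sub>R s"
  have "tangent_trace p (\<lambda>v w. (4 * (B p v \<bullet> B p w)) *\<^sub>R s) = tangent_trace p ?b"
    by (rule tangent_trace_cong) (simp add: norm_diag_polarized(2)[OF p])
  also have "\<dots> = (\<Sum>e\<in>Basis. ?b e e) - ?b p p"
  proof (rule tangent_trace_bilinear[OF p])
    show "bilinear ?b"
      unfolding bilinear_def
      by (auto intro!: linearI simp: B_add_left B_add_right B_scaleR_left B_scaleR_right
          inner_add_left inner_add_right algebra_simps)
  qed
  also have "\<dots> = (2 * DIM('a) - laplace \<bullet> quad p) *\<^sub>R s"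
  proof -
    have "(\<Sum>e\<in>Basis. 2 * (e \<bullet> e) - quad p \<bullet> (2 *\<^sub>R B e e)) = 2 * DIM('a) - quad p \<bullet> laplace"
      by (simp add: sum_subtractf laplace_def inner_sum_right sum_distrib_left)
    moreover have "2 * (p \<bullet> p) - quad p \<bullet> (2 *\<^sub>R B p p) = 0"
      using p quad_sphere[OF p] by (simp add: norm_eq_1 flip: quad_def)
    ultimately show ?thesis
      by (simp add: inner_commute[of laplace] flip: scaleR_sum_left)
  qed
  finally show ?thesis .
qed

end

section \<open>Biharmonicity at constant height\<close>

text \<open>
  The hypothesis puts the image of the unit sphere on a hyperplane section orthogonal to
  \<open>laplace\<close>. The value \<open>DIM('a)\<close> is the height at which the Laplacian and
  curvature terms of the bitension field cancel.
\<close>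

locale quadratic_at_constant_height = spherical_quadratic +
  assumes height: "laplace \<bullet> quad x = DIM('a) * (x \<bullet> x)"
begin

lemma laplace_quad: "p \<in> sphere 0 1 \<Longrightarrow> laplace \<bullet> quad p = DIM('a)"
  by (simp add: height norm_eq_1)

lemma tension_eq:
  "p \<in> sphere 0 1 \<Longrightarrow> tension quad p = laplace - DIM('a) *\<^sub>R quad p"
  by (simp add: tension_quad tangent_proj_def laplace_quad inner_commute[of _ laplace])

lemma laplace_B_tangent:
  assumes "v \<in> tangent_space p"
  shows "laplace \<bullet> B p v = 0"
proof -
  have "laplace \<bullet> quad (p + v) = laplace \<bullet> quad p + laplace \<bullet> quad v + 2 * (laplace \<bullet> B p v)"
    by (simp add: quad_def B_add_left B_add_right sym[of v p] inner_add_right)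
  then show ?thesis
    using assms by (simp add: height inner_add_left inner_add_right inner_commute[of v p]
        tangent_space_def algebra_simps)
qed

lemma tension_B_tangent:
  assumes "p \<in> sphere 0 1" "v \<in> tangent_space p"
  shows "tension quad p \<bullet> B p v = 0"
  using assms
  by (simp add: tension_eq inner_diff_left laplace_B_tangent norm_diag_polarized(1))

text \<open>
  At constant height the tension field is \<open>laplace - DIM('a) *\<^sub>R quad\<close> with the
  first summand constant, so its derivative is a multiple of that of \<open>quad\<close>, which is
  already tangent to the target sphere.
\<close>

lemma pullback_conn_tension:
  assumes p: "p \<in> sphere 0 1" and v: "v \<in> tangent_space p"
  shows "pullback_conn quad (tension quad) p v = (- 2 * real DIM('a)) *\<^sub>R B p v"
proof -
  have "((\<lambda>q. laplace - DIM('a) *\<^sub>R quad q) has_derivative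
      (\<lambda>v. 0 - real DIM('a) *\<^sub>R (2 *\<^sub>R B p v))) (at p within sphere 0 1)"
    by (intro has_derivative_diff has_derivative_const has_derivative_scaleR_right
        quad_has_derivative)
  from sphere_deriv_transform[OF p v tension_eq this]
  have "sphere_deriv (tension quad) p v = (- 2 * real DIM('a)) *\<^sub>R B p v" by simp
  then show ?thesis
    by (simp only: pullback_conn_def linear_cmul[OF linear_tangent_proj]
        tangent_proj_id[OF quad_tangent[OF p v]])
qed

lemma nabla2_tension:
  assumes p: "p \<in> sphere 0 1" and v: "v \<in> tangent_space p" and w: "w \<in> tangent_space p"
  shows "nabla2 quad (tension quad) (extend_field v) (extend_field w) p
    = - real DIM('a) *\<^sub>R tangent_proj (quad p) (2 *\<^sub>R B v w)"
proof -
  have "sphere_deriv (\<lambda>q. pullback_conn quad (tension quad) q (extend_field w q)) p v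
      = (- 2 * real DIM('a)) *\<^sub>R (B v w - (v \<bullet> w) *\<^sub>R quad p)"
    by (rule sphere_deriv_quad_field[OF p v w])
      (rule pullback_conn_tension, simp_all add: extend_field_tangent)
  moreover have "levi_civita (extend_field v) (extend_field w) p = 0"
    using w by (simp add: levi_civita_extend_field[OF p] tangent_space_def)
  moreover have "pullback_conn quad (tension quad) p 0 = 0"
    by (simp add: pullback_conn_tension[OF p] tangent_space_def bounded_bilinear.zero_right[OF bilin])
  ultimately show ?thesis
    by (simp add: nabla2_def pullback_conn_def[of _ _ p v] extend_field_at[OF v] tangent_proj_diff
        linear_cmul[OF linear_tangent_proj] linear_neg[OF linear_tangent_proj]
        tangent_proj_self[OF quad_sphere[OF p]])
qed

text \<open>
  The covariant derivative of the tension field is \<open>- DIM('a)\<close> times the differential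
  of \<open>quad\<close>, so its own divergence is \<open>- DIM('a)\<close> times the tension field.
\<close>

lemma rough_laplacian_tension:
  assumes p: "p \<in> sphere 0 1"
  shows "rough_laplacian quad (tension quad) p = DIM('a) *\<^sub>R tension quad p"
proof -
  define L where "L x = - real DIM('a) *\<^sub>R tangent_proj (quad p) x" for x
  have L: "linear L"
    unfolding L_def by (intro linear_compose_scale_right linear_tangent_proj)
  have "tangent_trace p (\<lambda>v w. nabla2 quad (tension quad) (extend_field v) (extend_field w) p)
      = tangent_trace p (\<lambda>v w. L (2 *\<^sub>R B v w))"
    unfolding L_def by (intro tangent_trace_cong nabla2_tension p)
  also have "\<dots> = L (laplace - 2 *\<^sub>R quad p)"
    by (rule tangent_trace_B[OF p L])
  also have "\<dots> = - real DIM('a) *\<^sub>R tension quad p"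
    by (simp add: L_def tension_quad[OF p] tangent_proj_diff linear_cmul[OF linear_tangent_proj]
        tangent_proj_self[OF quad_sphere[OF p]])
  finally show ?thesis by (simp add: rough_laplacian_def)
qed

lemma curvature_tension:
  assumes p: "p \<in> sphere 0 1" and v: "v \<in> tangent_space p"
  shows "curvature (extend_field (sphere_deriv quad p v)) (extend_field (tension quad p))
      (extend_field (sphere_deriv quad p v)) (quad p)
    = (4 * (B p v \<bullet> B p v)) *\<^sub>R (- tension quad p)"
proof -
  have T: "2 *\<^sub>R B p v \<in> tangent_space (quad p)" "tension quad p \<in> tangent_space (quad p)"
    using quad_tangent[OF p v] tangent_proj_in[OF quad_sphere[OF p]]
    by (simp_all add: tension_quad[OF p]) (simp add: tangent_space_def)
  show ?thesis
    unfolding sphere_deriv_quad[OF p v]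
    using curvature_sphere[OF quad_sphere[OF p] T(1) T(2) T(1)] tension_B_tangent[OF p v]
    by simp
qed

text \<open>
  The curvature trace is minus the energy density times the tension field, and at this height the
  energy density \<open>2 * DIM('a) - DIM('a)\<close> equals the eigenvalue of the rough Laplacian.
\<close>

lemma bitension_zero:
  assumes p: "p \<in> sphere 0 1"
  shows "bitension quad p = 0"
proof -
  have "tangent_trace p (\<lambda>v w. curvature (extend_field (sphere_deriv quad p v))
        (extend_field (tension quad p)) (extend_field (sphere_deriv quad p w)) (quad p))
      = tangent_trace p (\<lambda>v w. (4 * (B p v \<bullet> B p w)) *\<^sub>R (- tension quad p))"
    by (intro tangent_trace_cong curvature_tension p)
  also have "\<dots> = - real DIM('a) *\<^sub>R tension quad p"
    by (simp only: tangent_trace_energy[OF p] laplace_quad[OF p]) simp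
  finally show ?thesis
    by (simp add: bitension_def rough_laplacian_tension[OF p])
qed

text \<open>
  Otherwise \<open>laplace\<close> would be \<open>DIM('a) *\<^sub>R quad p\<close>, with squared
  norm \<open>DIM('a)\<^sup>2\<close>. But pairing \<open>laplace\<close> with itself as twice a sum
  of \<open>DIM('a)\<close> values of \<open>quad\<close>, all of height \<open>DIM('a)\<close>,
  gives \<open>2 * DIM('a)\<^sup>2\<close>.
\<close>

lemma tension_nonzero:
  assumes p: "p \<in> sphere 0 1"
  shows "tension quad p \<noteq> 0"
proof
  assume "tension quad p = 0"
  then have l: "laplace = DIM('a) *\<^sub>R quad p" by (simp add: tension_eq[OF p])
  have "laplace \<bullet> laplace = 2 * (\<Sum>b\<in>Basis. laplace \<bullet> quad b)"
    by (subst (2) laplace_def) (simp add: inner_sum_right quad_def)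
  then have "laplace \<bullet> laplace = 2 * DIM('a) * DIM('a)"
    by (simp add: height)
  moreover have "laplace \<bullet> laplace = DIM('a) * DIM('a)"
    by (subst (2) l) (simp add: laplace_quad[OF p])
  ultimately show False by simp
qed

theorem proper_biharmonic_quad: "proper_biharmonic quad"
proof -
  obtain b :: 'a where "b \<in> Basis" using nonempty_Basis by blast
  then have "b \<in> sphere 0 1" by simp
  then have "\<not> harmonic quad"
    using tension_nonzero unfolding harmonic_def by blast
  then show ?thesis
    by (simp add: proper_biharmonic_def biharmonic_def smooth_quad bitension_zero)
qed

end


section \<open>Bilinear forms as homogeneous polynomials\<close>

lemma homogeneous_polynomial_monomial:
  "homogeneous_polynomial 2 (\<lambda>x. x $ i * x $ j)"
proof -
  \<comment> \<open>The exponent is \<open>2\<close> at \<open>i\<close> when \<open>i = j\<close>.\<close>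
  define \<beta> :: "'a \<Rightarrow> nat" where "\<beta> k = of_bool (k = i) + of_bool (k = j)" for k
  have \<beta>: "(\<Sum>k\<in>UNIV. \<beta> k) = (2::nat)"
    by (simp add: \<beta>_def sum.distrib of_bool_def)
  have "x $ i * x $ j
      = (\<Sum>\<alpha> | (\<Sum>k\<in>UNIV. \<alpha> k) = 2. of_bool (\<alpha> = \<beta>) * (\<Prod>k\<in>UNIV. (x $ k) ^ \<alpha> k))"
    for x :: "real ^ 'a"
  proof -
    have "(\<Sum>\<alpha> | (\<Sum>k\<in>UNIV. \<alpha> k) = 2. of_bool (\<alpha> = \<beta>) * (\<Prod>k\<in>UNIV. (x $ k) ^ \<alpha> k))
        = (\<Sum>\<alpha>\<in>{\<beta>}. of_bool (\<alpha> = \<beta>) * (\<Prod>k\<in>UNIV. (x $ k) ^ \<alpha> k))"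
      by (rule sum.mono_neutral_right) (auto simp: finite_multi_indices \<beta>)
    also have "\<dots> = (\<Prod>k\<in>UNIV. (x $ k) ^ of_bool (k = i) * (x $ k) ^ of_bool (k = j))"
      by (simp add: \<beta>_def power_add)
    also have "\<dots> = x $ i * x $ j"
      by (simp add: prod.distrib of_bool_def if_distrib[of "\<lambda>n. _ ^ n"] cong: if_cong)
    finally show ?thesis by simp
  qed
  then show ?thesis
    unfolding homogeneous_polynomial_def by (intro exI allI)
qed

lemma homogeneous_polynomial_cmult:
  assumes "homogeneous_polynomial d P"
  shows "homogeneous_polynomial d (\<lambda>x. k * P x)"
proof -
  from assms obtain c where
    "\<forall>x. P x = (\<Sum>\<alpha> | (\<Sum>i\<in>UNIV. \<alpha> i) = d. c \<alpha> * (\<Prod>i\<in>UNIV. (x $ i) ^ \<alpha> i))"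
    unfolding homogeneous_polynomial_def by blast
  then show ?thesis
    unfolding homogeneous_polynomial_def
    by (intro exI[of _ "\<lambda>\<alpha>. k * c \<alpha>"]) (simp add: sum_distrib_left mult.assoc)
qed

lemma homogeneous_polynomial_sum:
  assumes "\<And>j. j \<in> J \<Longrightarrow> homogeneous_polynomial d (P j)"
  shows "homogeneous_polynomial d (\<lambda>x. \<Sum>j\<in>J. P j x)"
proof -
  have "\<forall>j\<in>J. \<exists>c. \<forall>x. P j x = (\<Sum>\<alpha> | (\<Sum>i\<in>UNIV. \<alpha> i) = d. c \<alpha> * (\<Prod>i\<in>UNIV. (x $ i) ^ \<alpha> i))"
    using assms unfolding homogeneous_polynomial_def by blast
  then obtain c where c: "\<forall>j\<in>J. \<forall>x. P j x
      = (\<Sum>\<alpha> | (\<Sum>i\<in>UNIV. \<alpha> i) = d. c j \<alpha> * (\<Prod>i\<in>UNIV. (x $ i) ^ \<alpha> i))"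
    by metis
  have "(\<Sum>j\<in>J. P j x)
      = (\<Sum>\<alpha> | (\<Sum>i\<in>UNIV. \<alpha> i) = d. (\<Sum>j\<in>J. c j \<alpha>) * (\<Prod>i\<in>UNIV. (x $ i) ^ \<alpha> i))" for x
    using c by (simp add: sum_distrib_right) (rule sum.swap)
  then show ?thesis
    unfolding homogeneous_polynomial_def by (intro exI allI)
qed

lemma homogeneous_polynomial_bilinear:
  assumes "bilinear b"
  shows "homogeneous_polynomial 2 (\<lambda>x. b x x)"
proof -
  have lin: "linear (\<lambda>x. b x y)" "linear (b y)" for y
    using assms by (auto simp: bilinear_def)
  have "b x x = (\<Sum>i\<in>UNIV. \<Sum>j\<in>UNIV. b (axis i 1) (axis j 1) * (x $ i * x $ j))" for x
  proof -
    have "b x x = b (\<Sum>i\<in>UNIV. (x $ i) *\<^sub>R axis i 1) (\<Sum>j\<in>UNIV. (x $ j) *\<^sub>R axis j 1)"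
      using basis_expansion[of x] by (simp add: scalar_mult_eq_scaleR)
    also have "\<dots> = (\<Sum>i\<in>UNIV. (x $ i) *\<^sub>R b (axis i 1) (\<Sum>j\<in>UNIV. (x $ j) *\<^sub>R axis j 1))"
      by (subst linear_sum[OF lin(1)]) (simp add: linear_cmul[OF lin(1)])
    also have "\<dots> = (\<Sum>i\<in>UNIV. \<Sum>j\<in>UNIV. b (axis i 1) (axis j 1) * (x $ i * x $ j))"
      by (simp add: linear_sum[OF lin(2)] linear_cmul[OF lin(2)] sum_distrib_left mult_ac)
    finally show ?thesis .
  qed
  then show ?thesis
    by (simp add: homogeneous_polynomial_sum homogeneous_polynomial_cmult
        homogeneous_polynomial_monomial)
qed

section \<open>Quadratic map from the gradient of the Cartan cubic\<close>

lemma sum_Basis_axis: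
  fixes f :: "real ^ 'n \<Rightarrow> 'b::comm_monoid_add"
  shows "(\<Sum>b\<in>Basis. f b) = (\<Sum>i\<in>UNIV. f (axis i (1 :: real)))"
proof -
  have "Basis = range (\<lambda>i :: 'n. axis i (1 :: real))"
    by (auto simp: Basis_vec_def)
  moreover have "inj (\<lambda>i :: 'n. axis i (1 :: real))"
    by (auto simp: inj_def axis_eq_axis)
  ultimately show ?thesis by (metis (mono_tags, lifting) sum.reindex_cong)
qed

lemma UNIV_5: "(UNIV :: 5 set) = {0, 1, 2, 3, 4}"
  by (rule card_subset_eq[symmetric]) simp_all

lemma UNIV_6: "(UNIV :: 6 set) = {0, 1, 2, 3, 4, 5}"
  by (rule card_subset_eq[symmetric]) simp_all

lemma sum_UNIV_5: "(\<Sum>i\<in>UNIV. f (i::5)) = f 0 + f 1 + f 2 + f 3 + f 4"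
  unfolding UNIV_5 by (simp add: add.assoc)

lemma sum_UNIV_6: "(\<Sum>i\<in>UNIV. f (i::6)) = f 0 + f 1 + f 2 + f 3 + f 4 + f 5"
  unfolding UNIV_6 by (simp add: add.assoc)

lemma forall_6: "(\<forall>i::6. P i) \<longleftrightarrow> P 0 \<and> P 1 \<and> P 2 \<and> P 3 \<and> P 4 \<and> P 5"
  using UNIV_6 by (metis UNIV_I empty_iff insert_iff)

text \<open>
  The first five components of \<open>sqrt 2 *\<^sub>R cartan_form x x\<close> are one third of the
  gradient of the Cartan cubic \<open>x\<^sub>0\<^sup>3 - 3 x\<^sub>0 x\<^sub>1\<^sup>2 + (3/2)
  x\<^sub>0 (x\<^sub>2\<^sup>2 + x\<^sub>3\<^sup>2 - 2 x\<^sub>4\<^sup>2) + (3 sqrt 3 / 2) x\<^sub>1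
  (x\<^sub>2\<^sup>2 - x\<^sub>3\<^sup>2) + 3 sqrt 3 x\<^sub>2 x\<^sub>3 x\<^sub>4\<close>, and the
  last one is \<open>\<bar>x\<bar>\<^sup>2\<close>; the bilinear form is obtained by polarization.
  The indices of the types \<open>5\<close> and \<open>6\<close> are taken to be \<open>0, \<dots>,
  4\<close> and \<open>0, \<dots>, 5\<close>.
\<close>

definition cartan_form :: "real ^ 5 \<Rightarrow> real ^ 5 \<Rightarrow> real ^ 6"
  where "cartan_form x y = (\<chi> i.
    if i = 0 then x$0 * y$0 - x$1 * y$1 + (x$2 * y$2 + x$3 * y$3) / 2 - x$4 * y$4
    else if i = 1 then sqrt 3 / 2 * (x$2 * y$2 - x$3 * y$3) - (x$0 * y$1 + x$1 * y$0)
    else if i = 2 then (x$0 * y$2 + x$2 * y$0) / 2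
      + sqrt 3 / 2 * (x$1 * y$2 + x$2 * y$1 + x$3 * y$4 + x$4 * y$3)
    else if i = 3 then (x$0 * y$3 + x$3 * y$0) / 2
      + sqrt 3 / 2 * (x$2 * y$4 + x$4 * y$2 - x$1 * y$3 - x$3 * y$1)
    else if i = 4 then sqrt 3 / 2 * (x$2 * y$3 + x$3 * y$2) - (x$0 * y$4 + x$4 * y$0)
    else x \<bullet> y) /\<^sub>R sqrt 2"

lemma cartan_form_nth:
  "(sqrt 2 *\<^sub>R cartan_form x y) $ 0
    = x$0 * y$0 - x$1 * y$1 + (x$2 * y$2 + x$3 * y$3) / 2 - x$4 * y$4"
  "(sqrt 2 *\<^sub>R cartan_form x y) $ 1
    = sqrt 3 / 2 * (x$2 * y$2 - x$3 * y$3) - (x$0 * y$1 + x$1 * y$0)"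
  "(sqrt 2 *\<^sub>R cartan_form x y) $ 2 = (x$0 * y$2 + x$2 * y$0) / 2
      + sqrt 3 / 2 * (x$1 * y$2 + x$2 * y$1 + x$3 * y$4 + x$4 * y$3)"
  "(sqrt 2 *\<^sub>R cartan_form x y) $ 3 = (x$0 * y$3 + x$3 * y$0) / 2
      + sqrt 3 / 2 * (x$2 * y$4 + x$4 * y$2 - x$1 * y$3 - x$3 * y$1)"
  "(sqrt 2 *\<^sub>R cartan_form x y) $ 4
    = sqrt 3 / 2 * (x$2 * y$3 + x$3 * y$2) - (x$0 * y$4 + x$4 * y$0)"
  "(sqrt 2 *\<^sub>R cartan_form x y) $ 5 = x \<bullet> y"
  by (simp_all add: cartan_form_def)

lemma cartan_form_sym: "cartan_form x y = cartan_form y x"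
  by (simp add: cartan_form_def vec_eq_iff algebra_simps inner_commute[of x])

lemma bilinear_cartan_form: "bilinear cartan_form"
proof -
  have "linear (cartan_form x)" for x
  proof (rule linearI)
    fix y z k
    have "sqrt 2 *\<^sub>R cartan_form x (y + z)
        = sqrt 2 *\<^sub>R cartan_form x y + sqrt 2 *\<^sub>R cartan_form x z"
      unfolding vec_eq_iff forall_6 vector_add_component cartan_form_nth
      by (simp add: algebra_simps inner_add_right add_divide_distrib diff_divide_distrib)
    then show "cartan_form x (y + z) = cartan_form x y + cartan_form x z"
      by (simp flip: scaleR_add_right)
    have "sqrt 2 *\<^sub>R cartan_form x (k *\<^sub>R y) = k *\<^sub>R (sqrt 2 *\<^sub>R cartan_form x y)"
      unfolding vec_eq_iff forall_6 vector_scaleR_component[of k] cartan_form_nth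
      by (simp add: algebra_simps)
    then show "cartan_form x (k *\<^sub>R y) = k *\<^sub>R cartan_form x y"
      by (simp only: scaleR_left_commute[of k] scaleR_cancel_left) simp
  qed
  then show ?thesis
    by (simp add: bilinear_def cartan_form_sym[of _ y for y])
qed

lemma cartan_form_diag_nth:
  "(sqrt 2 *\<^sub>R cartan_form x x) $ 0
    = (x$0)\<^sup>2 - (x$1)\<^sup>2 + ((x$2)\<^sup>2 + (x$3)\<^sup>2) / 2 - (x$4)\<^sup>2"
  "(sqrt 2 *\<^sub>R cartan_form x x) $ 1
    = sqrt 3 / 2 * ((x$2)\<^sup>2 - (x$3)\<^sup>2) - 2 * (x$0) * (x$1)"
  "(sqrt 2 *\<^sub>R cartan_form x x) $ 2 = x$0 * x$2 + sqrt 3 * (x$1 * x$2 + x$3 * x$4)"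
  "(sqrt 2 *\<^sub>R cartan_form x x) $ 3 = x$0 * x$3 + sqrt 3 * (x$2 * x$4 - x$1 * x$3)"
  "(sqrt 2 *\<^sub>R cartan_form x x) $ 4 = sqrt 3 * x$2 * x$3 - 2 * x$0 * x$4"
  "(sqrt 2 *\<^sub>R cartan_form x x) $ 5 = (x$0)\<^sup>2 + (x$1)\<^sup>2 + (x$2)\<^sup>2 + (x$3)\<^sup>2 + (x$4)\<^sup>2"
  unfolding cartan_form_nth inner_vec_def sum_UNIV_5
  by (simp_all add: field_simps power2_eq_square)

text \<open>
  The first five squares add up to \<open>\<bar>x\<bar>\<^sup>4\<close>, which is the equation
  \<open>\<bar>\<nabla>f\<bar>\<^sup>2 = 9 \<bar>x\<bar>\<^sup>4\<close> of the Cartan cubic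
  \<open>f\<close>, and so does the last one; the factor \<open>1 / sqrt 2\<close> compensates for
  the doubling.
\<close>

lemma cartan_form_norm: "norm (cartan_form x x) = (norm x)\<^sup>2"
proof -
  \<comment> \<open>The irrational coefficient \<open>s = sqrt 3\<close> enters only through \<open>s\<^sup>2 = 3\<close>; the last summand is the multiple
    of \<open>s\<^sup>2 - 3\<close> that makes the identity hold for indeterminate \<open>s\<close>.\<close>
  have *: "(a\<^sup>2 - b\<^sup>2 + (c\<^sup>2 + d\<^sup>2) / 2 - e\<^sup>2)\<^sup>2 + (s / 2 * (c\<^sup>2 - d\<^sup>2) - 2 * a * b)\<^sup>2
      + (a * c + s * (b * c + d * e))\<^sup>2 + (a * d + s * (c * e - b * d))\<^sup>2
      + (s * c * d - 2 * a * e)\<^sup>2 = (a\<^sup>2 + b\<^sup>2 + c\<^sup>2 + d\<^sup>2 + e\<^sup>2)\<^sup>2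
      + (s\<^sup>2 - 3) * ((c\<^sup>2 - d\<^sup>2)\<^sup>2 / 4 + (b * c + d * e)\<^sup>2 + (c * e - b * d)\<^sup>2 + (c * d)\<^sup>2)"
    for a b c d e s :: real
    by (simp add: power2_eq_square field_simps)
  have "2 * (cartan_form x x \<bullet> cartan_form x x)
      = (sqrt 2 *\<^sub>R cartan_form x x) \<bullet> (sqrt 2 *\<^sub>R cartan_form x x)"
    by simp
  also have "\<dots> = (\<Sum>i\<in>UNIV. ((sqrt 2 *\<^sub>R cartan_form x x) $ i)\<^sup>2)"
    by (simp only: inner_vec_def inner_real_def power2_eq_square)
  also have "\<dots> = 2 * ((x$0)\<^sup>2 + (x$1)\<^sup>2 + (x$2)\<^sup>2 + (x$3)\<^sup>2 + (x$4)\<^sup>2)\<^sup>2"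
    unfolding sum_UNIV_6 cartan_form_diag_nth * by simp
  also have "(x$0)\<^sup>2 + (x$1)\<^sup>2 + (x$2)\<^sup>2 + (x$3)\<^sup>2 + (x$4)\<^sup>2 = x \<bullet> x"
    by (simp only: inner_vec_def inner_real_def sum_UNIV_5 power2_eq_square)
  finally have "cartan_form x x \<bullet> cartan_form x x = (x \<bullet> x)\<^sup>2" by simp
  then show ?thesis
    by (simp add: norm_eq_sqrt_inner)
qed

interpretation cartan: spherical_quadratic cartan_form
  by (intro spherical_quadratic.intro cartan_form_sym cartan_form_norm)
    (use bilinear_cartan_form bilinear_conv_bounded_bilinear in blast)

text \<open>
  The Cartan cubic is harmonic, hence so are its partial derivatives, and only the component
  \<open>\<bar>x\<bar>\<^sup>2\<close>, with Laplacian \<open>10\<close>, remains.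
\<close>

lemma cartan_laplace: "sqrt 2 *\<^sub>R cartan.laplace = 10 *\<^sub>R axis 5 1"
proof -
  have "sqrt 2 *\<^sub>R cartan.laplace = 2 *\<^sub>R (\<Sum>i\<in>UNIV. sqrt 2 *\<^sub>R cartan_form (axis i 1) (axis i 1))"
    unfolding cartan.laplace_def
    by (simp add: sum_Basis_axis scaleR_sum_right mult.commute)
  also have "\<dots> = 10 *\<^sub>R axis 5 1"
    unfolding vec_eq_iff forall_6 vector_scaleR_component[of 2] vector_add_component
      sum_UNIV_5 cartan_form_diag_nth
    by (simp add: axis_def inner_axis_axis)
  finally show ?thesis .
qed

interpretation cartan: quadratic_at_constant_height cartan_form
proof
  fix x :: "real ^ 5"
  have "2 * (cartan.laplace \<bullet> cartan.quad x)
      = (sqrt 2 *\<^sub>R cartan.laplace) \<bullet> (sqrt 2 *\<^sub>R cartan.quad x)" by simp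
  also have "\<dots> = 10 * (x \<bullet> x)"
    unfolding cartan_laplace cartan.quad_def by (simp only: inner_scaleR_left inner_axis' cartan_form_nth) simp
  finally show "cartan.laplace \<bullet> cartan.quad x = DIM(real ^ 5) * (x \<bullet> x)" by simp
qed

text \<open>
  A linear relation between the components on the sphere holds everywhere by homogeneity. Evaluating
  it at basis vectors and at sums of two of them forces its coefficients to vanish one after the
  other.
\<close>

lemma cartan_full: "full_sphere_map cartan.quad"
  unfolding full_sphere_map_def
proof
  assume "\<exists>W. subspace W \<and> W \<noteq> UNIV \<and> cartan.quad ` sphere 0 1 \<subseteq> sphere 0 1 \<inter> W"
  then obtain W where W: "subspace W" "W \<noteq> UNIV" "\<And>x. x \<in> sphere 0 1 \<Longrightarrow> cartan.quad x \<in> W"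
    by blast
  have "dim W < DIM(real ^ 6)"
    using W by (metis dim_eq_full dim_subset_UNIV le_neq_implies_less span_eq_iff)
  then obtain a where a: "a \<noteq> 0" "\<And>w. w \<in> W \<Longrightarrow> a \<bullet> w = 0"
    using orthogonal_to_subspace_exists[of W] W(1)
    by (metis orthogonal_def span_eq_iff)
  have zero: "(\<Sum>i\<in>UNIV. a $ i * (sqrt 2 *\<^sub>R cartan_form x x) $ i) = 0" for x
  proof -
    have "cartan_form x x = (norm x)\<^sup>2 *\<^sub>R cartan.quad (x /\<^sub>R norm x)" if "x \<noteq> 0"
      using that by (simp add: cartan.quad_def[symmetric] flip: cartan.quad_scaleR)
    moreover have "a \<bullet> cartan.quad (x /\<^sub>R norm x) = 0" if "x \<noteq> 0"
      using that by (intro a(2) W(3)) simp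
    ultimately have "a \<bullet> (sqrt 2 *\<^sub>R cartan_form x x) = 0"
      by (cases "x = 0") (simp_all add: bounded_bilinear.zero_left[OF cartan.bilin])
    then show ?thesis by (simp only: inner_vec_def inner_real_def)
  qed
  note zero = zero[unfolded sum_UNIV_6 cartan_form_diag_nth]
  have 0: "a $ 0 = 0" "a $ 5 = 0"
    using zero[of "axis 0 1"] zero[of "axis 1 1"] by (simp_all add: axis_def)
  have 1: "a $ 1 = 0"
    using zero[of "axis 2 1"] 0 by (simp add: axis_def)
  have "a $ 2 = 0" "a $ 3 = 0" "a $ 4 = 0"
    using zero[of "axis 0 1 + axis 2 1"] zero[of "axis 0 1 + axis 3 1"]
      zero[of "axis 0 1 + axis 4 1"] 0 1 by (simp_all add: axis_def)
  with 0 1 have "a = 0" by (simp add: vec_eq_iff forall_6)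
  with a(1) show False by blast
qed

theorem theorem2p5:
  shows "\<exists>\<phi> :: real ^ 5 \<Rightarrow> real ^ 6.
    full_sphere_map \<phi> \<and> proper_biharmonic \<phi> \<and>
    (\<forall>i. \<exists>P. homogeneous_polynomial 2 P \<and> (\<forall>x\<in>sphere 0 1. \<phi> x $ i = P x))"
proof (intro exI conjI allI ballI)
  show "full_sphere_map cartan.quad" by (rule cartan_full)
  show "proper_biharmonic cartan.quad" by (rule cartan.proper_biharmonic_quad)
  fix i
  have "bilinear (\<lambda>x y. cartan_form x y $ i)"
    using bilinear_cartan_form by (simp add: bilinear_def linear_iff)
  then show "homogeneous_polynomial 2 (\<lambda>x. cartan_form x x $ i)"
    by (rule homogeneous_polynomial_bilinear)
  show "cartan.quad x $ i = cartan_form x x $ i" for x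
    by (simp add: cartan.quad_def)
qed

end
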